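(* Let $m$ be a positive integer, $q=2^m$, and $F=\mathbb{F}_q$. Let $b,c\in F$ be arbitrary, and let $\mu_2(b,c)$ be the number of different 4-tuples $(x,y,z,u)$ of pairwise distinct elements of $F$ which are solutions over $F$ of the system \[ \begin{cases} x+y+z+u=1,\\ u^{2}+xy+xz+xu+yz+yu+zu=b^{2},\\ x^{3}+y^{3}+z^{3}+u^{3}=c. \end{cases} \] Put $k_1=b^2+c+1$ and $k_2=b^2+b+c+\sqrt{c}$ (where $\sqrt{c}$ is the unique element of $F$ whose square is $c$). \begin{enumerate} \item If $m$ is odd and $\mathrm{Tr}(c)=1$, or $m$ is even and $\mathrm{Tr}(c)=0$, then \[\mu_2(b,c)=\frac16\bigl(q-8+(-1)^{\mathrm{Tr}(b)}(K(k_1k_2)-3)\bigr).\] \item If $m$ is odd and $\mathrm{Tr}(c)=0$, or $m$ is even and $\mathrm{Tr}(c)=1$, then \[\mu_2(b,c)=\frac16\bigl(q-2-(-1)^{\mathrm{Tr}(b)}(K(k_1k_2)+3)\bigr).\] \end{enumerate}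
   Context: $\mathrm{Tr}$ denotes the absolute trace from $F=\mathbb{F}_{2^m}$ to $\mathbb{F}_2$, $\mathrm{Tr}(x)=\sum_{i=0}^{m-1}x^{2^i}$. For $a\in F$, the Kloosterman sum is $K(a)=\sum_{x\in F\setminus\{0\}}(-1)^{\mathrm{Tr}(ax+1/x)}$.
   Formalization: The hypothesis k_1k_2 ≠ 0 is added: without it the formulas fail (e.g. m=3, b=c=0 gives 2/3), and they fail for every such pair (b,c). "Different 4-tuples" are counted up to permutation of x, y, z; the ordered count is 6 times larger. *)

theory Defs
  imports Complex_Main "HOL-Computational_Algebra.Primes" "HOL-Library.Cardinality"
begin

text \<open>
  The field with \<open>2 ^ m\<close> elements is a type \<open>'a ::finite_field\<close> with \<open>CARD('a) = 2 ^ m\<close>.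
  The absolute trace takes its values in the prime field \<open>{0, 1}\<close> of \<open>'a\<close>.
\<close>

definition Tr :: "nat \<Rightarrow> 'a::finite_field \<Rightarrow> 'a" where
  "Tr m x = (\<Sum>i<m. x ^ (2 ^ i))"

definition sgn_Tr :: "nat \<Rightarrow> 'a::finite_field \<Rightarrow> int" where
  "sgn_Tr m x = (if Tr m x = 0 then 1 else -1)"

definition Kloosterman :: "nat \<Rightarrow> 'a::finite_field \<Rightarrow> int" where
  "Kloosterman m a = (\<Sum>x\<in>UNIV - {0}. sgn_Tr m (a * x + 1 / x))"

definition field_sqrt :: "'a::finite_field \<Rightarrow> 'a" where
  "field_sqrt c = (THE s. s\<^sup>2 = c)"

definition solutions :: "'a::finite_field \<Rightarrow> 'a \<Rightarrow> ('a \<times> 'a \<times> 'a \<times> 'a) set" where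
  "solutions b c = {(x, y, z, u). distinct [x, y, z, u] \<and>
     x + y + z + u = 1 \<and>
     u\<^sup>2 + x*y + x*z + x*u + y*z + y*u + z*u = b\<^sup>2 \<and>
     x^3 + y^3 + z^3 + u^3 = c}"

text \<open>
  The system is symmetric in \<open>x, y, z\<close>, but not in \<open>u\<close>.  Solutions that differ only by a
  permutation of \<open>x, y, z\<close> are not counted as different; this is where the factor \<open>1/6\<close>
  in the closed formulas for \<open>mu2\<close> comes from.
\<close>

definition mu2 :: "'a::finite_field \<Rightarrow> 'a \<Rightarrow> nat" where
  "mu2 b c = card ((\<lambda>(x, y, z, u). ({x, y, z}, u)) ` solutions b c)"

lemma two_eq_0:
  assumes "CARD('a::finite_field) = 2 ^ m"
  shows "(2::'a) = 0"
proof -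
  have "(\<Sum>x\<in>(UNIV::'a set). x + 1) = (\<Sum>x\<in>UNIV. x)"
    by (rule sum.reindex_bij_witness[of _ "\<lambda>x. x - 1" "\<lambda>x. x + 1"]) auto
  hence "of_nat CARD('a) = (0::'a)"
    by (simp add: sum.distrib)
  thus ?thesis
    by (simp add: assms)
qed

lemma add_self_eq_0:
  assumes "CARD('a::finite_field) = 2 ^ m"
  shows "(x::'a) + x = 0"
  by (metis assms two_eq_0 mult_2 mult_zero_left)

lemma ex1_sqrt:
  assumes "CARD('a::finite_field) = 2 ^ m"
  shows "\<exists>!s::'a. s\<^sup>2 = c"
proof -
  have eq: "x = y" if "x\<^sup>2 = y\<^sup>2" for x y :: 'a
  proof -
    have "x = y \<or> x = - y"
      using that by (simp add: power2_eq_iff)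
    moreover have "- y = y"
      using add_self_eq_0[OF assms, of y] by (simp add: minus_unique)
    ultimately show ?thesis by auto
  qed
  hence "inj (\<lambda>x::'a. x\<^sup>2)"
    by (rule injI)
  hence "surj (\<lambda>x::'a. x\<^sup>2)"
    by (simp add: finite_UNIV_inj_surj)
  then obtain s where "s\<^sup>2 = c"
    by (metis surjD)
  thus ?thesis
    using eq by (intro ex1I[of _ s]) auto
qed

lemma field_sqrt_square:
  assumes "CARD('a::finite_field) = 2 ^ m"
  shows "(field_sqrt (c::'a))\<^sup>2 = c"
  unfolding field_sqrt_def by (rule theI'[OF ex1_sqrt[OF assms]])

lemma Tr_in_prime_field:
  fixes x :: "'a::finite_field"
  assumes "CARD('a) = 2 ^ m"
  shows "Tr m x \<in> {0, 1}"
proof -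
  have sq_add: "(a + b)\<^sup>2 = a\<^sup>2 + b\<^sup>2" for a b :: 'a
    using two_eq_0[OF assms] by (simp add: power2_sum)
  have sq_sum: "(\<Sum>i<n. f i)\<^sup>2 = (\<Sum>i<n. (f i)\<^sup>2)" for f :: "nat \<Rightarrow> 'a" and n
    by (induction n) (simp_all add: sq_add)
  have "(Tr m x)\<^sup>2 = (\<Sum>i<m. x ^ (2 ^ Suc i))"
    by (simp add: Tr_def sq_sum flip: power_mult) (simp add: mult.commute)
  hence "(Tr m x)\<^sup>2 + x = (\<Sum>i<Suc m. x ^ (2 ^ i))"
    by (subst sum.lessThan_Suc_shift) (simp add: add.commute)
  also have "\<dots> = Tr m x + x"
    using finite_field_power_card_eq_same[of x] by (simp add: Tr_def assms)
  finally have "Tr m x * (Tr m x - 1) = 0"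
    by (simp add: power2_eq_square algebra_simps)
  thus ?thesis
    by auto
qed

end

theory Submission
  imports Defs "HOL-Computational_Algebra.Polynomial"
begin

text \<open>
  Write \<open>\<chi>(x) = (-1)^Tr(x)\<close> and \<open>h = b + \<surd>c + 1\<close>, so that \<open>k1 = h\<^sup>2\<close> and \<open>k2 = h\<^sup>2 + h\<close>.
  With \<open>t = x + u\<close> (hence \<open>y + z = 1 + t\<close>) the system becomes
  \<open>x\<^sup>2 + x = b\<^sup>2 + k1/t\<close> and \<open>y\<^sup>2 + (1 + t) y = b\<^sup>2 + t x + t\<close>.
  For fixed \<open>t \<noteq> 0, 1\<close> the first equation has \<open>1 + \<chi>(b) \<chi>(k1/t)\<close> roots \<open>x\<close>, and for each of them the
  second has \<open>1 + \<chi>(k1/(t(1+t)\<^sup>2)) = 1 + \<chi>(k1/t) \<chi>(k2/(1+t))\<close> roots \<open>y\<close>, independently of \<open>x\<close>.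
  Expanding the product and summing over \<open>t\<close> gives two linear character sums and one sum
  which the substitution \<open>t = 1/(1+z)\<close> turns into \<open>K(k1 k2)\<close>.
  Of the required inequalities only \<open>x \<noteq> y\<close> and \<open>x \<noteq> z\<close> can fail; they do so only for \<open>t = h\<close>.
\<close>

section \<open>Trace and additive character in characteristic 2\<close>

lemma minus_eq_self:
  assumes "CARD('a::finite_field) = 2 ^ m"
  shows "- (x::'a) = x"
  using add_self_eq_0[OF assms, of x] by (simp add: minus_unique)

lemma add_eq_0_iff_eq:
  assumes "CARD('a::finite_field) = 2 ^ m"
  shows "(x::'a) + y = 0 \<longleftrightarrow> x = y"
  by (metis add_eq_0_iff minus_eq_self[OF assms])

lemma add_eq_iff_eq_add:
  assumes "CARD('a::finite_field) = 2 ^ m"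
  shows "(x::'a) + y = z \<longleftrightarrow> x = z + y"
  by (metis add_diff_cancel_right' diff_conv_add_uminus minus_eq_self[OF assms])

lemma add_left_cancel_self:
  assumes "CARD('a::finite_field) = 2 ^ m"
  shows "(x::'a) + (x + y) = y"
  by (simp add: add_self_eq_0[OF assms] flip: add.assoc)

text \<open>Used together as a normaliser for polynomial identities in characteristic 2:
  \<open>ring_expand\<close> multiplies out and sorts monomials, so that equal ones become adjacent,
  and \<open>char2_simps\<close> cancels them in pairs.\<close>

lemmas char2_simps = add_self_eq_0 add_left_cancel_self minus_eq_self
lemmas ring_expand = power2_eq_square power3_eq_cube distrib_left distrib_right ac_simps

lemma power2_add_char2:
  assumes "CARD('a::finite_field) = 2 ^ m"
  shows "((x::'a) + y)\<^sup>2 = x\<^sup>2 + y\<^sup>2"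
  using two_eq_0[OF assms] by (simp add: power2_sum)

lemma power_two_power_add_char2:
  assumes "CARD('a::finite_field) = 2 ^ m"
  shows "((x::'a) + y) ^ 2 ^ i = x ^ 2 ^ i + y ^ 2 ^ i"
proof (induction i)
  case (Suc i)
  have pow: "a ^ 2 ^ Suc i = (a ^ 2 ^ i)\<^sup>2" for a :: 'a
    by (simp add: mult.commute flip: power_mult)
  show ?case
    unfolding pow Suc.IH by (rule power2_add_char2[OF assms])
qed simp

lemma Tr_add:
  assumes "CARD('a::finite_field) = 2 ^ m"
  shows "Tr m ((x::'a) + y) = Tr m x + Tr m y"
  by (simp add: Tr_def power_two_power_add_char2[OF assms] sum.distrib)

text \<open>Squaring permutes the summands of the trace cyclically, because
  \<open>x ^ 2 ^ m = x\<close>.\<close>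

lemma Tr_power2:
  assumes "CARD('a::finite_field) = 2 ^ m"
  shows "Tr m ((x::'a)\<^sup>2) = Tr m x"
proof -
  have "Tr m (x\<^sup>2) + x = (\<Sum>i<Suc m. x ^ (2 ^ i))"
    by (subst sum.lessThan_Suc_shift) (simp add: Tr_def add.commute flip: power_mult)
  also have "\<dots> = Tr m x + x"
    using finite_field_power_card_eq_same[of x] by (simp add: Tr_def assms)
  finally show ?thesis by simp
qed

lemma sgn_Tr_add:
  assumes "CARD('a::finite_field) = 2 ^ m"
  shows "sgn_Tr m ((x::'a) + y) = sgn_Tr m x * sgn_Tr m y"
  using Tr_in_prime_field[OF assms, of x] Tr_in_prime_field[OF assms, of y]
    two_eq_0[OF assms]
  by (auto simp: sgn_Tr_def Tr_add[OF assms])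

lemma sgn_Tr_power2:
  assumes "CARD('a::finite_field) = 2 ^ m"
  shows "sgn_Tr m ((x::'a)\<^sup>2) = sgn_Tr m x"
  by (simp add: sgn_Tr_def Tr_power2[OF assms])

lemma sgn_Tr_0 [simp]: "sgn_Tr m 0 = 1"
  by (simp add: sgn_Tr_def Tr_def power_0_left)

lemma sgn_Tr_mult_self [simp]: "sgn_Tr m x * sgn_Tr m x = 1"
  by (simp add: sgn_Tr_def)

text \<open>The source of the parity of \<open>m\<close> in the final case distinction: the trace of
  1 is the \<open>m\<close>-fold sum of 1.\<close>

lemma sgn_Tr_1:
  assumes "CARD('a::finite_field) = 2 ^ m"
  shows "sgn_Tr m (1::'a) = (-1) ^ m"
proof -
  have "of_nat m = (if even m then 0 else 1 :: 'a)"
  proof (cases "even m")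
    case True
    then obtain k where "m = 2 * k" ..
    then show ?thesis using two_eq_0[OF assms] by simp
  next
    case False
    then obtain k where "m = 2 * k + 1" by (rule oddE)
    then show ?thesis using two_eq_0[OF assms] by simp
  qed
  then show ?thesis
    by (simp add: sgn_Tr_def Tr_def)
qed

section \<open>The kernel of the trace and Artin-Schreier equations\<close>

text \<open>The trace is a polynomial function of degree \<open>2 ^ (m - 1)\<close>, so it has at
  most that many roots.\<close>

lemma card_Tr_eq_0_le:
  assumes "CARD('a::finite_field) = 2 ^ m" "m > 0"
  shows "card {x::'a. Tr m x = 0} \<le> 2 ^ (m - 1)"
proof -
  define p :: "'a poly" where "p = (\<Sum>i<m. monom 1 (2 ^ i))"
  have poly: "poly p x = Tr m x" for x
    by (simp add: p_def Tr_def poly_sum poly_monom)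
  have "coeff p (2 ^ (m - 1)) = (\<Sum>i<m. if i = m - 1 then 1 else 0)"
    by (simp add: p_def coeff_sum)
  then have "p \<noteq> 0"
    using assms(2) by auto
  moreover have "degree p \<le> 2 ^ (m - 1)"
    unfolding p_def by (rule degree_sum_le) (auto simp: degree_monom_eq)
  ultimately show ?thesis
    using card_poly_roots_bound[of p] by (simp add: poly)
qed

lemma power2_add_self_eq_iff:
  assumes "CARD('a::finite_field) = 2 ^ m"
  shows "(x::'a)\<^sup>2 + x = y\<^sup>2 + y \<longleftrightarrow> x = y \<or> x = y + 1"
proof -
  have "(x\<^sup>2 + x) + (y\<^sup>2 + y) = (x + y) * (x + (y + 1))"
    by (simp add: ring_expand char2_simps[OF assms])
  then have "x\<^sup>2 + x = y\<^sup>2 + y \<longleftrightarrow> (x + y) * (x + (y + 1)) = 0"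
    by (metis add_eq_0_iff_eq[OF assms])
  then show ?thesis
    by (simp add: add_eq_0_iff_eq[OF assms])
qed

lemma card_artin_schreier_fibre:
  assumes "CARD('a::finite_field) = 2 ^ m"
  shows "card {x::'a. x\<^sup>2 + x = y\<^sup>2 + y} = 2"
proof -
  have "{x. x\<^sup>2 + x = y\<^sup>2 + y} = {y, y + 1}"
    by (auto simp: power2_add_self_eq_iff[OF assms])
  then show ?thesis by simp
qed

text \<open>Additive Hilbert 90. The map is two-to-one, so its image has \<open>2 ^ (m - 1)\<close>
  elements; it lies in the trace kernel, which is no larger.\<close>

lemma range_artin_schreier:
  assumes "CARD('a::finite_field) = 2 ^ m" "m > 0"
  shows "range (\<lambda>x::'a. x\<^sup>2 + x) = {x. Tr m x = 0}"
proof (rule card_seteq)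
  let ?f = "\<lambda>x::'a. x\<^sup>2 + x"
  show "range ?f \<subseteq> {x. Tr m x = 0}"
    by (auto simp: Tr_add[OF assms(1)] Tr_power2[OF assms(1)] add_self_eq_0[OF assms(1)])
  have "CARD('a) = (\<Sum>a\<in>range ?f. card {x. ?f x = a})"
    using sum.image_gen[of "UNIV::'a set" "\<lambda>_. 1::nat" ?f] by simp
  also have "\<dots> = (\<Sum>a\<in>range ?f. 2)"
    by (rule sum.cong) (auto simp: card_artin_schreier_fibre[OF assms(1)])
  finally have "2 * card (range ?f) = 2 * 2 ^ (m - 1)"
    using assms by (simp add: power_eq_if)
  then show "card {x::'a. Tr m x = 0} \<le> card (range ?f)"
    using card_Tr_eq_0_le[OF assms] by simp
qed simp

lemma card_artin_schreier:
  assumes "CARD('a::finite_field) = 2 ^ m" "m > 0"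
  shows "int (card {x::'a. x\<^sup>2 + x = a}) = 1 + sgn_Tr m a"
proof (cases "Tr m a = 0")
  case True
  then obtain y where "a = y\<^sup>2 + y"
    using range_artin_schreier[OF assms] by blast
  with True show ?thesis
    by (simp add: card_artin_schreier_fibre[OF assms(1)] sgn_Tr_def)
next
  case False
  then have "{x. x\<^sup>2 + x = a} = {}"
    using range_artin_schreier[OF assms] by blast
  with False show ?thesis
    by (simp add: sgn_Tr_def)
qed

text \<open>The scaling \<open>y = w * x\<close> reduces the equation to Artin-Schreier
  form.\<close>

lemma card_quadratic_roots:
  assumes "CARD('a::finite_field) = 2 ^ m" "m > 0" "w \<noteq> 0"
  shows "int (card {y::'a. y\<^sup>2 + w * y = a}) = 1 + sgn_Tr m (a / w\<^sup>2)"
proof -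
  have "bij_betw (\<lambda>y. y / w) {y. y\<^sup>2 + w * y = a} {x. x\<^sup>2 + x = a / w\<^sup>2}"
    by (rule bij_betw_byWitness[where f' = "\<lambda>x. w * x"])
      (use assms(3) in \<open>auto simp: field_simps power2_eq_square\<close>)
  then show ?thesis
    by (simp add: bij_betw_same_card card_artin_schreier[OF assms(1,2)])
qed

section \<open>Linear character sums\<close>

text \<open>Orthogonality: translating by \<open>y / a\<close> with \<open>Tr m y\<close> nonzero
  changes the sign of the sum. Such a \<open>y\<close> exists because the trace kernel is a proper
  subset.\<close>

lemma sum_sgn_Tr:
  assumes "CARD('a::finite_field) = 2 ^ m" "m > 0" "a \<noteq> 0"
  shows "(\<Sum>x\<in>UNIV. sgn_Tr m (a * x :: 'a)) = 0"
proof -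
  have "card {x::'a. Tr m x = 0} < CARD('a)"
    using card_Tr_eq_0_le[OF assms(1,2)] assms(1,2)
    by (metis diff_less less_numeral_extra(1) one_less_numeral_iff order_le_less_trans
        power_strict_increasing_iff semiring_norm(76))
  then obtain y :: 'a where y: "Tr m y \<noteq> 0"
    by (metis (mono_tags, lifting) UNIV_eq_I less_irrefl mem_Collect_eq)
  have "(\<Sum>x\<in>UNIV. sgn_Tr m (a * x)) = (\<Sum>x\<in>UNIV. sgn_Tr m (a * (x + y / a)))"
    by (rule sum.reindex_bij_witness[of _ "\<lambda>x. x + y / a" "\<lambda>x. x - y / a"]) auto
  also have "\<dots> = (\<Sum>x\<in>UNIV. sgn_Tr m (a * x) * sgn_Tr m y)"
    using assms(3) by (simp add: distrib_left sgn_Tr_add[OF assms(1)])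
  also have "\<dots> = - (\<Sum>x\<in>UNIV. sgn_Tr m (a * x))"
    using y by (simp add: sgn_Tr_def sum_negf)
  finally show ?thesis by simp
qed

text \<open>Inversion permutes the field without 0 and 1, so only the terms at 0 and 1 are missing
  from a vanishing full sum.\<close>

lemma sum_sgn_Tr_inverse:
  assumes "CARD('a::finite_field) = 2 ^ m" "m > 0" "a \<noteq> 0"
  shows "(\<Sum>t\<in>UNIV - {0,1}. sgn_Tr m (a / t :: 'a)) = - 1 - sgn_Tr m a"
proof -
  have "(\<Sum>t\<in>UNIV - {0,1}. sgn_Tr m (a / t)) = (\<Sum>x\<in>UNIV - {0,1}. sgn_Tr m (a * x))"
    by (rule sum.reindex_bij_witness[of _ inverse inverse]) (auto simp: field_simps)
  also have "\<dots> = (\<Sum>x\<in>UNIV. sgn_Tr m (a * x)) - (\<Sum>x\<in>{0,1}. sgn_Tr m (a * x))"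
    by (rule sum_diff) auto
  finally show ?thesis
    by (simp add: sum_sgn_Tr[OF assms])
qed

section \<open>The character sums of the count\<close>

text \<open>In the partial fraction expansion the double pole is the square of
  \<open>h / (1 + t)\<close>; as the trace is invariant under squaring, it merges with the simple
  pole at \<open>t = 1\<close>.\<close>

lemma sgn_Tr_partial_fractions:
  fixes h t :: "'a::finite_field"
  assumes "CARD('a) = 2 ^ m" "t \<noteq> 0" "t \<noteq> 1"
  shows "sgn_Tr m (h\<^sup>2 / (t * (1 + t)\<^sup>2)) = sgn_Tr m (h\<^sup>2 / t) * sgn_Tr m ((h\<^sup>2 + h) / (1 + t))"
proof -
  have nz: "1 + t \<noteq> 0"
    using assms(3) by (metis add_eq_0_iff_eq[OF assms(1)])
  have "h\<^sup>2 / (t * (1 + t)\<^sup>2) = h\<^sup>2 / t + h\<^sup>2 / (1 + t) + (h / (1 + t))\<^sup>2"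
  proof -
    have "h\<^sup>2 / t + h\<^sup>2 / (1 + t) + (h / (1 + t))\<^sup>2
        = (h\<^sup>2 * (1 + t)\<^sup>2 + h\<^sup>2 * t * (1 + t) + h\<^sup>2 * t) / (t * (1 + t)\<^sup>2)"
      using nz assms(2) by (simp add: divide_simps) (simp add: power2_eq_square algebra_simps)
    also have "h\<^sup>2 * (1 + t)\<^sup>2 + h\<^sup>2 * t * (1 + t) + h\<^sup>2 * t = h\<^sup>2"
      by (simp add: ring_expand char2_simps[OF assms(1)])
    finally show ?thesis by simp
  qed
  then show ?thesis
    by (simp add: sgn_Tr_add[OF assms(1)] sgn_Tr_power2[OF assms(1)] add_divide_distrib)
qed

text \<open>With \<open>z = 1 + 1 / t\<close> one has \<open>k / t = k + k * z\<close> and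
  \<open>j / (1 + t) = j + j / z\<close>. The final \<open>- 1\<close> is the term
  \<open>z = 1\<close>, which no \<open>t\<close> reaches.\<close>

lemma sum_sgn_Tr_Kloosterman:
  fixes k j :: "'a::finite_field"
  assumes "CARD('a) = 2 ^ m" "j \<noteq> 0"
  shows "(\<Sum>t\<in>UNIV - {0,1}. sgn_Tr m (k / t) * sgn_Tr m (j / (1 + t)))
    = sgn_Tr m (k + j) * Kloosterman m (k * j) - 1"
proof -
  note add = sgn_Tr_add[OF assms(1)] and iff = add_eq_0_iff_eq[OF assms(1)]
  note two = two_eq_0[OF assms(1)]
  have "(\<Sum>t\<in>UNIV - {0,1}. sgn_Tr m (k / t) * sgn_Tr m (j / (1 + t)))
      = (\<Sum>z\<in>UNIV - {0,1}. sgn_Tr m (k + j) * sgn_Tr m (k * z + j / z))"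
  proof (rule sum.reindex_bij_witness[of _ "\<lambda>z. 1 / (1 + z)" "\<lambda>t. 1 + 1 / t"])
    fix t :: 'a assume t: "t \<in> UNIV - {0,1}"
    then have nz: "1 + t \<noteq> 0" "t \<noteq> 0" using iff[of 1 t] by auto
    have a: "1 + (1 + 1 / t) = 1 / t" using two by (simp flip: add.assoc)
    show "1 / (1 + (1 + 1 / t)) = t" by (simp add: a)
    show "1 + 1 / t \<in> UNIV - {0,1}"
      using nz by (auto simp: divide_simps add.commute)
    have "(1 + t) + 1 = t"
      using two by (simp add: ac_simps flip: add.assoc)
    then have "1 / (1 + 1 / t) = 1 + 1 / (1 + t)"
      using nz by (simp add: divide_simps add.commute)
    then have "j / (1 + 1 / t) = j + j / (1 + t)"
      by (metis distrib_left mult.right_neutral times_divide_eq_right)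
    then have "k + j + (k * (1 + 1 / t) + j / (1 + 1 / t)) = k / t + j / (1 + t)"
      by (simp add: distrib_left ac_simps char2_simps[OF assms(1)])
    then show "sgn_Tr m (k + j) * sgn_Tr m (k * (1 + 1 / t) + j / (1 + 1 / t))
      = sgn_Tr m (k / t) * sgn_Tr m (j / (1 + t))"
      by (metis add)
  next
    fix z :: 'a assume z: "z \<in> UNIV - {0,1}"
    then have nz: "1 + z \<noteq> 0" "z \<noteq> 0" using iff[of 1 z] by auto
    show "1 + 1 / (1 / (1 + z)) = z" using two by (simp flip: add.assoc)
    show "1 / (1 + z) \<in> UNIV - {0,1}" using nz by (auto simp: divide_simps)
  qed
  also have "\<dots> = sgn_Tr m (k + j) * (\<Sum>z\<in>UNIV - {0,1}. sgn_Tr m (k * z + j / z))"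
    by (simp add: sum_distrib_left)
  also have "(\<Sum>z\<in>UNIV - {0,1}. sgn_Tr m (k * z + j / z))
      = (\<Sum>z\<in>UNIV - {0}. sgn_Tr m (k * z + j / z)) - sgn_Tr m (k + j)"
    using sum_diff1[of "UNIV - {0}" "\<lambda>z. sgn_Tr m (k * z + j / z)" 1]
    by (simp add: Diff_insert2[symmetric] insert_commute)
  \<comment> \<open>The scaling \<open>z = j * x\<close> turns \<open>k * z + j / z\<close> into
    \<open>k * j * x + 1 / x\<close>.\<close>
  also have "(\<Sum>z\<in>UNIV - {0}. sgn_Tr m (k * z + j / z)) = Kloosterman m (k * j)"
    unfolding Kloosterman_def
    by (rule sum.reindex_bij_witness[of _ "\<lambda>x. j * x" "\<lambda>z. z / j"])
      (use assms(2) in \<open>auto simp: field_simps\<close>)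
  finally show ?thesis
    by (simp add: right_diff_distrib)
qed

section \<open>Counting the solutions\<close>

text \<open>Elimination: the linear equation fixes \<open>z\<close>, the second becomes a quadratic
  in \<open>y\<close>, and modulo it the cubic one involves only \<open>t\<close> and
  \<open>x\<close>.\<close>

lemma solutions_param_iff:
  fixes b c h t x y :: "'a::finite_field"
  assumes "CARD('a) = 2 ^ m" "h\<^sup>2 = b\<^sup>2 + c + 1" "h \<noteq> 0"
  shows "(x, y, 1 + t + y, x + t) \<in> solutions b c \<longleftrightarrow>
    t \<noteq> 0 \<and> t \<noteq> 1 \<and> x\<^sup>2 + x = b\<^sup>2 + h\<^sup>2 / t \<and> y\<^sup>2 + (1 + t) * y = b\<^sup>2 + t * x + t \<and>
    \<not> (t = h \<and> (y = x \<or> y = x + 1 + t))"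
proof -
  note ch = char2_simps[OF assms(1)] and iff = add_eq_0_iff_eq[OF assms(1)]
  let ?z = "1 + t + y" and ?u = "x + t"
  \<comment> \<open>\<open>D\<close> is the defect of the quadratic in \<open>y\<close>; it is also
    exactly the defect of the second equation of the system.\<close>
  define D where "D = y\<^sup>2 + (1 + t) * y + (b\<^sup>2 + t * x + t)"
  have D0: "y\<^sup>2 + (1 + t) * y = b\<^sup>2 + t * x + t \<longleftrightarrow> D = 0"
    by (simp add: D_def iff)
  have e1: "x + y + ?z + ?u = 1"
    by (simp add: ac_simps ch)
  have "(?u\<^sup>2 + x*y + x*?z + x*?u + y*?z + y*?u + ?z*?u) + b\<^sup>2 = D"
    by (simp add: D_def ring_expand ch)
  then have e2: "?u\<^sup>2 + x*y + x*?z + x*?u + y*?z + y*?u + ?z*?u = b\<^sup>2 \<longleftrightarrow> D = 0"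
    by (metis iff)
  have "(x^3 + y^3 + ?z^3 + ?u^3) + c = t * (x\<^sup>2 + x) + (t * b\<^sup>2 + h\<^sup>2) + (1 + t) * D"
    unfolding assms(2) by (simp add: D_def ring_expand ch)
  then have e3: "x^3 + y^3 + ?z^3 + ?u^3 = c \<longleftrightarrow> t * (x\<^sup>2 + x) = t * b\<^sup>2 + h\<^sup>2" if "D = 0"
    using that by (metis iff add_0_right mult_zero_right)
  \<comment> \<open>The value \<open>t = 0\<close> would force \<open>h^2 = 0\<close>, so division
    by \<open>t\<close> loses nothing.\<close>
  have div: "t * (x\<^sup>2 + x) = t * b\<^sup>2 + h\<^sup>2 \<longleftrightarrow> t \<noteq> 0 \<and> x\<^sup>2 + x = b\<^sup>2 + h\<^sup>2 / t"
    using assms(3) by (cases "t = 0") (auto simp: field_simps)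
  have dist: "distinct [x, y, ?z, ?u] \<longleftrightarrow> t \<noteq> 1 \<and> \<not> (t = h \<and> (y = x \<or> y = x + 1 + t))"
    if Q: "D = 0" and P: "t * (x\<^sup>2 + x) = t * b\<^sup>2 + h\<^sup>2"
  proof -
    have t0: "t \<noteq> 0" using P assms(3) by auto
    have u: "y \<noteq> ?u" "?z \<noteq> ?u"
    proof -
      \<comment> \<open>This product equals \<open>h^2\<close>, which is nonzero, so
        \<open>u\<close> never meets \<open>y\<close> or \<open>z\<close>.\<close>
      have "(y + ?u) * (?z + ?u) * t = t * D + t * (x\<^sup>2 + x) + t * b\<^sup>2"
        by (simp add: D_def ring_expand ch)
      then have "(y + ?u) * (?z + ?u) * t = h\<^sup>2"
        unfolding P Q by (simp add: ac_simps ch)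
      then show "y \<noteq> ?u" "?z \<noteq> ?u"
        using assms(3) iff[of y ?u] iff[of ?z ?u]
        by (metis mult_zero_left power2_eq_square mult_eq_0_iff)+
    qed
    have yz: "y = ?z \<longleftrightarrow> t = 1"
      using iff[of 1 t] by auto
    have xy: "t = h" if "y = x \<or> y = x + 1 + t"
    proof -
      \<comment> \<open>The second factor is \<open>x + z\<close>. On solutions the product is
        \<open>(t + h)^2\<close>, so \<open>x\<close> can meet \<open>y\<close> or \<open>z\<close>
        only at \<open>t = h\<close>.\<close>
      have "(x + y) * (x + y + 1 + t) * t = t * D + t\<^sup>2 + t * (x\<^sup>2 + x) + t * b\<^sup>2"
        by (simp add: D_def ring_expand ch)
      then have "(x + y) * (x + y + 1 + t) * t = t\<^sup>2 + h\<^sup>2"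
        unfolding P Q by (simp add: ac_simps ch)
      moreover have "(x + y) * (x + y + 1 + t) = 0"
        using that by (auto simp: ac_simps ch)
      ultimately have "(t + h)\<^sup>2 = 0"
        using power2_add_char2[OF assms(1)] by simp
      then show ?thesis using iff by auto
    qed
    have xz: "x = ?z \<longleftrightarrow> y = x + 1 + t"
      by (metis add_eq_iff_eq_add[OF assms(1)] add.commute add.assoc)
    show ?thesis
      using t0 u yz xy xz by auto
  qed
  show ?thesis
    unfolding solutions_def mem_Collect_eq prod.case
    using D0 e1 e2 e3 div dist by blast
qed

text \<open>The triples \<open>(t, x, y)\<close> satisfying both quadratic equations form
  \<open>A\<close>; those with \<open>x = y\<close> or \<open>x = z\<close> form \<open>E\<close>,
  and the solutions correspond to \<open>A - E\<close>.\<close>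

lemma card_solutions:
  fixes b c h :: "'a::finite_field"
  assumes "CARD('a) = 2 ^ m" "m > 0" "h\<^sup>2 = b\<^sup>2 + c + 1" "h \<noteq> 0" "h \<noteq> 1"
  shows "int (card (solutions b c)) = 2 ^ m - 5 - 3 * sgn_Tr m b
    - 3 * (sgn_Tr m b * sgn_Tr m h) + sgn_Tr m h * Kloosterman m (h\<^sup>2 * (h\<^sup>2 + h))"
proof -
  note ch = char2_simps[OF assms(1)] and iff = add_eq_0_iff_eq[OF assms(1)]
    and add = sgn_Tr_add[OF assms(1)] and sq = sgn_Tr_power2[OF assms(1)]
  define X where "X t = {x. x\<^sup>2 + x = b\<^sup>2 + h\<^sup>2 / t}" for t
  define Y where "Y t x = {y. y\<^sup>2 + (1 + t) * y = b\<^sup>2 + t * x + t}" for t x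
  define A where "A = (SIGMA t:UNIV - {0,1}. SIGMA x:X t. Y t x)"
  define E where "E = (SIGMA t:{h}. SIGMA x:X t. {x, x + 1 + t})"
  have [simp]: "h + h = 0" "1 + h \<noteq> 0"
    using iff assms(5) by metis+
  have EA: "E \<subseteq> A"
  proof -
    \<comment> \<open>At \<open>t = h\<close> the term \<open>h^2 / t\<close> is just
      \<open>h\<close>, which makes \<open>x\<close> itself a root of the quadratic for
      \<open>y\<close>; the other root is \<open>x + (1 + h)\<close>. Hence all of \<open>E\<close>
      has to be subtracted.\<close>
    have "x\<^sup>2 + (1 + h) * x = b\<^sup>2 + h * x + h \<and>
      (x + 1 + h)\<^sup>2 + (1 + h) * (x + 1 + h) = b\<^sup>2 + h * x + h" if "x \<in> X h" for x
    proof -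
      have "x\<^sup>2 + x = b\<^sup>2 + h"
        using that assms(4) by (simp add: X_def power2_eq_square)
      then have "x\<^sup>2 + (1 + h) * x = b\<^sup>2 + h * x + h"
        by (simp add: distrib_right flip: add.assoc)
      moreover have "(x + 1 + h)\<^sup>2 + (1 + h) * (x + 1 + h) = x\<^sup>2 + (1 + h) * x"
        by (simp add: ring_expand ch)
      ultimately show ?thesis by simp
    qed
    then show ?thesis
      using assms(4,5) by (auto simp: E_def A_def Y_def)
  qed
  have "bij_betw (\<lambda>(t, x, y). (x, y, 1 + t + y, x + t)) (A - E) (solutions b c)"
  proof (rule bij_betw_byWitness[where f' = "\<lambda>(x, y, z, u). (x + u, x, y)"])
    have mem: "(t, x, y) \<in> A - E \<longleftrightarrow> (x, y, 1 + t + y, x + t) \<in> solutions b c" for t x y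
      unfolding solutions_param_iff[OF assms(1,3,4)] A_def E_def X_def Y_def by auto
    note cancel = add_left_cancel_self[OF assms(1)]
    have z: "1 + (x + u) + y = z" if "(x, y, z, u) \<in> solutions b c" for x y z u
    proof -
      have one: "1 = x + y + z + u" using that by (simp add: solutions_def)
      show ?thesis unfolding one by (simp add: ac_simps ch)
    qed
    show "\<forall>p\<in>A - E. (case case p of (t, x, y) \<Rightarrow> (x, y, 1 + t + y, x + t) of
        (x, y, z, u) \<Rightarrow> (x + u, x, y)) = p"
      by (auto simp: cancel)
    show "\<forall>p\<in>solutions b c. (case case p of (x, y, z, u) \<Rightarrow> (x + u, x, y) of
        (t, x, y) \<Rightarrow> (x, y, 1 + t + y, x + t)) = p"
      by (auto simp: cancel z)
    show "(\<lambda>(t, x, y). (x, y, 1 + t + y, x + t)) ` (A - E) \<subseteq> solutions b c"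
      using mem by auto
    show "(\<lambda>(x, y, z, u). (x + u, x, y)) ` solutions b c \<subseteq> A - E"
    proof (clarify, unfold mem)
      fix x y z u assume sol: "(x, y, z, u) \<in> solutions b c"
      then show "(x, y, 1 + (x + u) + y, x + (x + u)) \<in> solutions b c"
        by (simp add: cancel z[OF sol])
    qed
  qed
  then have "card (solutions b c) = card (A - E)"
    by (simp add: bij_betw_same_card)
  then have "int (card (solutions b c)) = int (card A) - int (card E)"
    using EA by (simp add: card_Diff_subset card_mono of_nat_diff finite_subset)
  moreover have cardX: "int (card (X t)) = 1 + sgn_Tr m b * sgn_Tr m (h\<^sup>2 / t)" for t
    by (simp add: X_def card_artin_schreier[OF assms(1,2)] add sq)
  have "int (card E) = 2 * (1 + sgn_Tr m b * sgn_Tr m h)"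
  proof -
    have "card {x, x + 1 + h} = 2" for x :: 'a
      using \<open>1 + h \<noteq> 0\<close> by (simp add: add.assoc)
    then have "card E = card (X h) * 2"
      by (simp add: E_def card_SigmaI)
    then show ?thesis
      using cardX[of h] assms(4) by (simp add: power2_eq_square)
  qed
  moreover have "int (card A) = 2 ^ m - 3 - 3 * sgn_Tr m b - sgn_Tr m b * sgn_Tr m h
    + sgn_Tr m h * Kloosterman m (h\<^sup>2 * (h\<^sup>2 + h))"
  proof -
    let ?k = "\<lambda>t. sgn_Tr m (h\<^sup>2 / t)" and ?j = "\<lambda>t. sgn_Tr m ((h\<^sup>2 + h) / (1 + t))"
    have "h\<^sup>2 + h = h * (1 + h)" by (simp add: power2_eq_square algebra_simps)
    then have nz: "h\<^sup>2 + h \<noteq> 0" using assms(4) by simp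
    have cardY: "int (card (Y t x)) = 1 + ?k t * ?j t"
      if t: "t \<noteq> 0" "t \<noteq> 1" and x: "x \<in> X t" for t x
    proof -
      have nz: "1 + t \<noteq> 0" using t(2) iff by metis
      \<comment> \<open>Substituting for \<open>b^2\<close> and using \<open>t * i = 1 + i\<close>,
        the quotient deciding solvability splits into \<open>(x * i)^2 + x * i\<close>,
        \<open>i^2 + i\<close> and \<open>h^2 / (t * (1 + t)^2)\<close>. The first two have trace 0,
        so the root count does not depend on \<open>x\<close>.\<close>
      define i where "i = inverse (1 + t)"
      define k where "k = h\<^sup>2 / t"
      have "(1 + t) * i = 1" using nz by (simp add: i_def)
      then have "t * i = 1 + i"
        by (simp add: distrib_right) (metis add.commute add_eq_iff_eq_add[OF assms(1)])
      then have ti: "t * i\<^sup>2 = i + i\<^sup>2"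
        by (simp add: power2_eq_square distrib_right flip: mult.assoc)
      have "x\<^sup>2 + x = b\<^sup>2 + k" using x by (simp add: X_def k_def)
      then have b2: "b\<^sup>2 = x\<^sup>2 + x + k"
        by (metis add_eq_iff_eq_add[OF assms(1)])
      have "(b\<^sup>2 + t * x + t) * i\<^sup>2 = (x * i)\<^sup>2 + x * i + (i\<^sup>2 + i) + k * i\<^sup>2"
      proof -
        have "(b\<^sup>2 + t * x + t) * i\<^sup>2 = x\<^sup>2 * i\<^sup>2 + x * i\<^sup>2 + k * i\<^sup>2 + x * (t * i\<^sup>2) + t * i\<^sup>2"
          unfolding b2 by (simp add: distrib_left distrib_right ac_simps)
        also have "\<dots> = (x * i)\<^sup>2 + x * i + (i\<^sup>2 + i) + k * i\<^sup>2"
          unfolding ti by (simp add: ring_expand ch)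
        finally show ?thesis .
      qed
      then have "(b\<^sup>2 + t * x + t) / (1 + t)\<^sup>2 = (x * i)\<^sup>2 + x * i + (i\<^sup>2 + i) + h\<^sup>2 / (t * (1 + t)\<^sup>2)"
        by (simp add: i_def k_def divide_inverse power_inverse mult.assoc)
      then have "sgn_Tr m ((b\<^sup>2 + t * x + t) / (1 + t)\<^sup>2) = sgn_Tr m (h\<^sup>2 / (t * (1 + t)\<^sup>2))"
        by (simp add: add sq)
      then show ?thesis
        unfolding Y_def card_quadratic_roots[OF assms(1,2) nz]
        using sgn_Tr_partial_fractions[OF assms(1) t] by simp
    qed
    have "int (card A) = (\<Sum>t\<in>UNIV - {0,1}. \<Sum>x\<in>X t. int (card (Y t x)))"
      by (simp add: A_def card_SigmaI)
    also have "\<dots> = (\<Sum>t\<in>UNIV - {0,1}. \<Sum>x\<in>X t. 1 + ?k t * ?j t)"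
      by (intro sum.cong) (auto simp: cardY)
    also have "\<dots> = (\<Sum>t\<in>UNIV - {0,1}. (1 + sgn_Tr m b * ?k t) * (1 + ?k t * ?j t))"
      by (simp add: cardX)
    also have "\<dots> = (\<Sum>t\<in>UNIV - {0,1}. 1 + sgn_Tr m b * ?k t + ?k t * ?j t + sgn_Tr m b * ?j t)"
    proof (rule sum.cong)
      fix t :: 'a
      have "?k t * (?k t * ?j t) = ?j t"
        by (simp flip: mult.assoc)
      then show "(1 + sgn_Tr m b * ?k t) * (1 + ?k t * ?j t)
          = 1 + sgn_Tr m b * ?k t + ?k t * ?j t + sgn_Tr m b * ?j t"
        by (simp add: algebra_simps)
    qed simp
    also have "\<dots> = int (card (UNIV - {0, 1::'a})) + sgn_Tr m b * (\<Sum>t\<in>UNIV - {0,1}. ?k t)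
        + (\<Sum>t\<in>UNIV - {0,1}. ?k t * ?j t) + sgn_Tr m b * (\<Sum>t\<in>UNIV - {0,1}. ?j t)"
      by (simp add: sum.distrib sum_distrib_left)
    also have "int (card (UNIV - {0, 1::'a})) = 2 ^ m - 2"
    proof -
      have "card {0, 1::'a} \<le> CARD('a)" by (rule card_mono) auto
      then show ?thesis using assms(1) by (simp add: card_Diff_subset of_nat_diff)
    qed
    also have "(\<Sum>t\<in>UNIV - {0,1}. ?k t) = - 1 - sgn_Tr m h"
      using sum_sgn_Tr_inverse[OF assms(1,2), of "h\<^sup>2"] assms(4) by (simp add: sq)
    also have "(\<Sum>t\<in>UNIV - {0,1}. ?k t * ?j t)
        = sgn_Tr m h * Kloosterman m (h\<^sup>2 * (h\<^sup>2 + h)) - 1"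
    proof -
      have "h\<^sup>2 + (h\<^sup>2 + h) = h" by (simp add: ch)
      with sum_sgn_Tr_Kloosterman[OF assms(1) nz, of "h\<^sup>2"] show ?thesis by metis
    qed
    \<comment> \<open>The shift \<open>t\<close> to \<open>1 + t\<close> swaps 0 and 1, and
      \<open>h^2 + h\<close> has trace 0, so both boundary terms equal 1.\<close>
    also have "(\<Sum>t\<in>UNIV - {0,1}. ?j t) = - 2"
    proof -
      have "1 + (1 + t) = t" for t :: 'a
        by (simp add: ch)
      then have "(\<Sum>t\<in>UNIV - {0,1}. ?j t) = (\<Sum>t\<in>UNIV - {0,1}. sgn_Tr m ((h\<^sup>2 + h) / t))"
        by (intro sum.reindex_bij_witness[of _ "\<lambda>t. 1 + t" "\<lambda>t. 1 + t"]) (auto simp: iff)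
      then show ?thesis
        using sum_sgn_Tr_inverse[OF assms(1,2) nz] by (simp add: add sq)
    qed
    finally show ?thesis by (simp add: algebra_simps)
  qed
  ultimately show ?thesis by simp
qed

section \<open>From ordered 4-tuples to unordered triples\<close>

text \<open>The system is symmetric in \<open>x, y, z\<close>, and these are distinct, so every
  fibre consists of the 6 orderings of one set.\<close>

lemma card_solutions_eq_mu2:
  fixes b c :: "'a::finite_field"
  shows "card (solutions b c) = 6 * mu2 b c"
proof -
  let ?f = "\<lambda>(x, y, z, u). ({x, y, z}, u :: 'a)"
  have fib: "card {p \<in> solutions b c. ?f p = s} = 6" if img: "s \<in> ?f ` solutions b c" for s
  proof -
    obtain x y z u where s: "s = ({x, y, z}, u)" and sol: "(x, y, z, u) \<in> solutions b c"
      using img by auto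
    have d: "x \<noteq> y" "x \<noteq> z" "y \<noteq> z"
      using sol by (auto simp: solutions_def)
    have perm: "(x, z, y, u) \<in> solutions b c" "(y, x, z, u) \<in> solutions b c"
      "(y, z, x, u) \<in> solutions b c" "(z, x, y, u) \<in> solutions b c" "(z, y, x, u) \<in> solutions b c"
      using sol by (auto simp: solutions_def algebra_simps)
    have "{p \<in> solutions b c. ?f p = s} =
      {(x, y, z, u), (x, z, y, u), (y, x, z, u), (y, z, x, u), (z, x, y, u), (z, y, x, u)}"
    proof (intro equalityI subsetI)
      fix p assume "p \<in> {p \<in> solutions b c. ?f p = s}"
      then obtain x' y' z' where p: "p = (x', y', z', u)" "{x', y', z'} = {x, y, z}"
        and d': "x' \<noteq> y'" "x' \<noteq> z'" "y' \<noteq> z'"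
        using s by (auto simp: solutions_def)
      have "x' \<in> {x, y, z}" "y' \<in> {x, y, z}" "z' \<in> {x, y, z}"
        using p(2) by auto
      then show "p \<in> {(x, y, z, u), (x, z, y, u), (y, x, z, u), (y, z, x, u), (z, x, y, u), (z, y, x, u)}"
        using p(1) d' by auto
    next
      fix p
      assume "p \<in> {(x, y, z, u), (x, z, y, u), (y, x, z, u), (y, z, x, u), (z, x, y, u), (z, y, x, u)}"
      then show "p \<in> {p \<in> solutions b c. ?f p = s}"
        using s sol perm by auto
    qed
    then show ?thesis
      using d by simp
  qed
  have "card (solutions b c) = (\<Sum>s\<in>?f ` solutions b c. card {p \<in> solutions b c. ?f p = s})"
    using sum.image_gen[of "solutions b c" "\<lambda>_. 1::nat" ?f] by simp
  also have "\<dots> = 6 * mu2 b c"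
    using fib by (simp add: mu2_def)
  finally show ?thesis .
qed

theorem theorem1:
  fixes m q :: nat
    and b c k1 k2 :: "'a::finite_field"
  assumes "m > 0"
    and "q = 2 ^ m"
    and "CARD('a) = q"
    and "k1 = b\<^sup>2 + c + 1"
    and "k2 = b\<^sup>2 + b + c + field_sqrt c"
    and "k1 * k2 \<noteq> 0"
  shows "(odd m \<and> Tr m c = 1 \<or> even m \<and> Tr m c = 0 \<longrightarrow>
            real (mu2 b c) = 1 / 6 * (real q - 8
              + real_of_int (sgn_Tr m b) * (real_of_int (Kloosterman m (k1 * k2)) - 3)))
       \<and> (odd m \<and> Tr m c = 0 \<or> even m \<and> Tr m c = 1 \<longrightarrow>
            real (mu2 b c) = 1 / 6 * (real q - 2
              - real_of_int (sgn_Tr m b) * (real_of_int (Kloosterman m (k1 * k2)) + 3)))"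
proof -
  have q: "CARD('a) = 2 ^ m" using assms(2,3) by simp
  note ch = char2_simps[OF q]
  define s where "s = field_sqrt c"
  define h where "h = b + s + 1"
  have s: "s\<^sup>2 = c" unfolding s_def by (rule field_sqrt_square[OF q])
  have h: "h\<^sup>2 = b\<^sup>2 + c + 1"
    by (simp add: h_def power2_add_char2[OF q] s)
  have k1: "k1 = h\<^sup>2"
    by (simp add: h assms(4))
  have k2: "k2 = h\<^sup>2 + h"
    unfolding assms(5) h s_def[symmetric] unfolding h_def by (simp add: ac_simps ch)
  \<comment> \<open>Here \<open>k1 * k2 = h^2 * (h^2 + h)\<close>, which vanishes at 0 and at
    1.\<close>
  have "h \<noteq> 0" "h \<noteq> 1"
    using assms(6) unfolding k1 k2 by (auto simp: ch)
  note card = card_solutions[OF q assms(1) h this]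
  \<comment> \<open>The sign of the trace of \<open>1 + c\<close>; it equals
    \<open>sgn_Tr m b * sgn_Tr m h\<close> and is 1 in the first case of the theorem and -1 in the
    second.\<close>
  define e where "e = (-1) ^ m * sgn_Tr m c"
  have "sgn_Tr m h = sgn_Tr m b * e"
    unfolding h_def e_def sgn_Tr_add[OF q] sgn_Tr_1[OF q] s[symmetric] sgn_Tr_power2[OF q]
    by simp
  then have "int (card (solutions b c)) = 2 ^ m - 5 - 3 * sgn_Tr m b - 3 * e
      + sgn_Tr m b * e * Kloosterman m (k1 * k2)"
    using card by (simp add: k1 k2 flip: mult.assoc)
  then have "real_of_int (6 * int (mu2 b c)) = real_of_int (2 ^ m - 5 - 3 * sgn_Tr m b - 3 * e
      + sgn_Tr m b * e * Kloosterman m (k1 * k2))"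
    unfolding card_solutions_eq_mu2 by simp
  then have mu: "real (mu2 b c) = 1 / 6 * (real q - 5 - 3 * sgn_Tr m b - 3 * e
      + sgn_Tr m b * e * Kloosterman m (k1 * k2))"
    by (simp add: assms(2))
  have "e = 1" if "odd m \<and> Tr m c = 1 \<or> even m \<and> Tr m c = 0"
    using that by (auto simp: e_def sgn_Tr_def)
  moreover have "e = - 1" if "odd m \<and> Tr m c = 0 \<or> even m \<and> Tr m c = 1"
    using that by (auto simp: e_def sgn_Tr_def)
  ultimately show ?thesis
    unfolding mu by (auto simp: algebra_simps)
qed

end
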